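(* Let $1\le m<n$ be integers, let $T$ be a real $(n\times m)$-matrix of full rank $m$ such that $\frac{1}{n\nu_n}\int_{S^{n-1}}\|T^t\eta\|^2\,d\eta=1$, let $\mu\geq 0$, let $s$ be a real number, and let $U$ be the solution of $\mathcal{L}U+\mu U=F$, that is, $\widehat{U}(\omega)=\widehat{F}(\omega)/(\|T^t\omega\|^2+\mu)$. For polynomials $P_k$ of order $k$ with $P_k(0)=1$, $k=0,1,2,\ldots$, let the iterates $U_k$ be given by $$(\widehat{U}-\widehat{U}_k)(\omega)=P_k\big(\alpha(\omega)(\|T^t\omega\|^2+\mu)\big)\,\widehat{U}(\omega),\quad \alpha(\omega)=\frac{1}{\|\omega\|^2+\mu}.$$ If the solution $U$ possesses a finite norm $\|U\|_s$, this also holds for the iterates $U_k$. For all coefficients $\mu\geq 0$, the corresponding norm of the error, given by $$\|U-U_k\|_s=\int_{\mathbb{R}^n}\|T^t\omega\|^s\,\big|P_k\big(\alpha(\omega)(\|T^t\omega\|^2+\mu)\big)\widehat{U}(\omega)\big|\,d\omega,$$ then tends to zero as $k$ goes to infinity for suitably chosen polynomials $P_k$ (of order $k$ with $P_k(0)=1$).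
   Context: $\|\cdot\|$ (on vectors) is the Euclidean norm, $T^t$ the transpose of $T$, $S^{n-1}$ the unit sphere of $\mathbb{R}^n$ with surface measure $d\eta$, $\nu_n$ the volume of the unit ball of $\mathbb{R}^n$. A polynomial of order $k$ is a real polynomial of degree at most $k$. All functions $U:\mathbb{R}^n\to\mathbb{R}$ considered possess the representation $U(y)=(2\pi)^{-n/2}\int\widehat{U}(\omega)e^{i\omega\cdot y}\,d\omega$ with an integrable function $\widehat{U}$, their Fourier transform. $\mathcal{L}$ is the operator given by $(\mathcal{L}U)(y)=(2\pi)^{-n/2}\int\|T^t\omega\|^2\widehat{U}(\omega)e^{i\omega\cdot y}\,d\omega$. The right-hand side $F:\mathbb{R}^n\to\mathbb{R}$ has an integrable Fourier transform $\widehat{F}$, and in the case $\mu=0$ the function $\omega\mapsto\widehat{F}(\omega)/\|T^t\omega\|^2$ is assumed to be integrable. For real $s$, the norm is $\|U\|_s=\int_{\mathbb{R}^n}\|T^t\omega\|^s\,|\widehat{U}(\omega)|\,d\omega$. *)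

theory Defs
  imports "HOL-Analysis.Analysis" "HOL-Computational_Algebra.Polynomial"
begin

text \<open>Surface measure on the unit sphere: \<open>n\<close> times the volume of the open cone
  (intersected with the unit ball) over a given Borel subset of the sphere.\<close>

definition sphere_measure :: "(real^'n) measure" where
  "sphere_measure = scale_measure (of_nat CARD('n))
     (distr (restrict_space lborel (ball 0 1 - {0})) (restrict_space borel (sphere 0 1)) sgn)"

lemma emeasure_sphere_measure:
  fixes A :: "(real^'n) set"
  assumes "A \<in> sets borel" "A \<subseteq> sphere 0 1"
  shows "emeasure sphere_measure A
    = of_nat CARD('n) * emeasure lborel {x \<in> ball 0 1 - {0}. sgn x \<in> A}"
proof -
  let ?B = "ball 0 1 - {0} :: (real^'n) set"
  have sgn: "(sgn :: real^'n \<Rightarrow> real^'n) \<in> borel_measurable borel"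
    unfolding sgn_div_norm by measurable
  have "sgn \<in> measurable (restrict_space lborel ?B) (restrict_space borel (sphere 0 1))"
    by (rule measurable_restrict_space2)
       (use sgn in \<open>auto intro!: measurable_restrict_space1 simp: space_restrict_space norm_sgn\<close>)
  moreover have "A \<in> sets (restrict_space borel (sphere 0 1))"
    using assms by (subst sets_restrict_space_iff) auto
  moreover have "sgn -` A \<inter> ?B = {x \<in> ?B. sgn x \<in> A}" by auto
  moreover have "emeasure (restrict_space lborel ?B) {x \<in> ?B. sgn x \<in> A}
      = emeasure lborel {x \<in> ?B. sgn x \<in> A}"
    by (rule emeasure_restrict_space) auto
  ultimately show ?thesis
    unfolding sphere_measure_def
    by (simp only: emeasure_scale_measure emeasure_distr space_restrict_space
        space_lborel space_borel Int_UNIV_right)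
qed

lemma emeasure_sphere_measure_space:
  "emeasure (sphere_measure :: (real^'n) measure) (sphere 0 1)
    = of_nat CARD('n) * emeasure lborel (ball 0 1 :: (real^'n) set)"
proof -
  have "{x \<in> ball 0 1 - {0}. sgn x \<in> sphere 0 1} = ball 0 1 - {0 :: real^'n}"
    by (auto simp: norm_sgn)
  moreover have "emeasure lborel (ball 0 1 - {0 :: real^'n}) = emeasure lborel (ball 0 1 :: (real^'n) set)"
    by (rule emeasure_Diff_null_set) auto
  ultimately show ?thesis
    by (subst emeasure_sphere_measure) auto
qed

definition inverse_fourier :: "(real^'n \<Rightarrow> complex) \<Rightarrow> real^'n \<Rightarrow> complex" where
  "inverse_fourier Uh y = of_real ((2 * pi) powr (- (real CARD('n) / 2))) *
     (\<integral>\<omega>. Uh \<omega> * exp (\<i> * of_real (\<omega> \<bullet> y)) \<partial>lebesgue)"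

text \<open>\<open>Uh\<close> is a Fourier transform of the real-valued function \<open>U\<close>. It is determined by \<open>U\<close>
  only up to null sets, so identities between transforms are stated almost everywhere.\<close>

definition fourier_repr :: "(real^'n \<Rightarrow> real) \<Rightarrow> (real^'n \<Rightarrow> complex) \<Rightarrow> bool" where
  "fourier_repr U Uh \<longleftrightarrow>
     integrable lebesgue Uh \<and> (\<forall>y. of_real (U y) = inverse_fourier Uh y)"

text \<open>The operator and the norms below act on a function through its Fourier transform \<open>Uh\<close>.\<close>

definition L_op :: "real^'m^'n \<Rightarrow> (real^'n \<Rightarrow> complex) \<Rightarrow> real^'n \<Rightarrow> complex" where
  "L_op T Uh = inverse_fourier (\<lambda>\<omega>. of_real ((norm (transpose T *v \<omega>))\<^sup>2) * Uh \<omega>)"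

text \<open>The value is \<open>\<infinity>\<close> if the norm is not finite. On the kernel of the transpose of \<open>T\<close>, a null
  set for \<open>T \<noteq> 0\<close>, \<open>powr\<close> yields \<open>0\<close> for every \<open>s\<close>.\<close>

definition snorm :: "real^'m^'n \<Rightarrow> real \<Rightarrow> (real^'n \<Rightarrow> complex) \<Rightarrow> ennreal" where
  "snorm T s Uh =
     (\<integral>\<^sup>+\<omega>. ennreal (norm (transpose T *v \<omega>) powr s * norm (Uh \<omega>)) \<partial>lebesgue)"

definition alpha :: "real \<Rightarrow> real^'n \<Rightarrow> real" where
  "alpha \<mu> \<omega> = 1 / ((norm \<omega>)\<^sup>2 + \<mu>)"

definition residual_factor :: "real^'m^'n \<Rightarrow> real \<Rightarrow> real poly \<Rightarrow> real^'n \<Rightarrow> real" where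
  "residual_factor T \<mu> p \<omega> = poly p (alpha \<mu> \<omega> * ((norm (transpose T *v \<omega>))\<^sup>2 + \<mu>))"

definition admissible_polys :: "(nat \<Rightarrow> real poly) \<Rightarrow> bool" where
  "admissible_polys P \<longleftrightarrow> (\<forall>k. degree (P k) \<le> k \<and> poly (P k) 0 = 1)"

definition iterates :: "real^'m^'n \<Rightarrow> real \<Rightarrow> (nat \<Rightarrow> real poly) \<Rightarrow> (real^'n \<Rightarrow> complex) \<Rightarrow>
    (nat \<Rightarrow> real^'n \<Rightarrow> real) \<Rightarrow> (nat \<Rightarrow> real^'n \<Rightarrow> complex) \<Rightarrow> bool" where
  "iterates T \<mu> P Uh V Vh \<longleftrightarrow>
     (\<forall>k. fourier_repr (V k) (Vh k) \<and>
        (AE \<omega> in lebesgue. Uh \<omega> - Vh k \<omega> = of_real (residual_factor T \<mu> (P k) \<omega>) * Uh \<omega>))"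

end

theory Submission
  imports Defs
begin

text \<open>The argument \<open>t\<close> of the polynomials is bounded by some \<open>M \<ge> 1\<close> and positive wherever
  \<open>transpose T *v \<omega> \<noteq> 0\<close>. Polynomials are bounded on \<open>[0, M]\<close>, which gives the finiteness of the
  norms. With \<open>P\<^sub>k(t) = (1 - t/M)\<^sup>k\<close> the residual factors are bounded by \<open>1\<close> and tend to zero
  pointwise for \<open>t > 0\<close>, so that dominated convergence applies. On the kernel of \<open>transpose T\<close> the
  weight vanishes, as \<open>0 powr s = 0\<close>.\<close>

lemma borel_measurable_matrix_vector_mult [measurable]:
  fixes A :: "real^'n^'m"
  shows "(\<lambda>\<omega>. A *v \<omega>) \<in> borel_measurable borel"
  by (intro borel_measurable_continuous_onI linear_continuous_on
      matrix_vector_mul_bounded_linear)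

lemma borel_measurable_residual_factor [measurable]:
  "residual_factor T \<mu> p \<in> borel_measurable borel"
proof -
  have "poly p \<in> borel_measurable borel"
    by (intro borel_measurable_continuous_onI continuous_intros)
  moreover have "(\<lambda>\<omega>. alpha \<mu> \<omega> * ((norm (transpose T *v \<omega>))\<^sup>2 + \<mu>)) \<in> borel_measurable borel"
    unfolding alpha_def by measurable
  ultimately show ?thesis
    unfolding residual_factor_def [abs_def] by (rule measurable_compose [rotated])
qed

text \<open>\<open>Uh\<close> is only Lebesgue measurable, so the Borel measurable weight is first
  carried over to the completion of \<open>lborel\<close>.\<close>

lemma borel_measurable_snorm_integrand:
  fixes T :: "real^'m^'n"
  assumes "Uh \<in> borel_measurable lebesgue"
  shows "(\<lambda>\<omega>. ennreal (norm (transpose T *v \<omega>) powr s * norm (Uh \<omega>))) \<in> borel_measurable lebesgue"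
proof -
  have "(\<lambda>\<omega>. norm (transpose T *v \<omega>) powr s) \<in> borel_measurable borel"
    by measurable
  then have "(\<lambda>\<omega>. norm (transpose T *v \<omega>) powr s) \<in> borel_measurable lborel"
    by simp
  then have "(\<lambda>\<omega>. norm (transpose T *v \<omega>) powr s) \<in> borel_measurable lebesgue"
    by (rule measurable_completion)
  then show ?thesis
    by (intro measurable_compose [OF _ measurable_ennreal] borel_measurable_times
        measurable_compose [OF assms borel_measurable_norm])
qed

lemma borel_measurable_residual_mult:
  fixes Uh :: "real^'n \<Rightarrow> complex"
  assumes "Uh \<in> borel_measurable lebesgue"
  shows "(\<lambda>\<omega>. of_real (residual_factor T \<mu> p \<omega>) * Uh \<omega>) \<in> borel_measurable lebesgue"
proof -
  have "(\<lambda>\<omega>. of_real (residual_factor T \<mu> p \<omega>) :: complex) \<in> borel_measurable borel"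
    by measurable
  then have "(\<lambda>\<omega>. of_real (residual_factor T \<mu> p \<omega>) :: complex) \<in> borel_measurable lebesgue"
    by (intro measurable_completion) simp
  then show ?thesis
    by (intro borel_measurable_times assms)
qed

lemma alpha_mult_nonneg:
  assumes "\<mu> \<ge> 0"
  shows "0 \<le> alpha \<mu> \<omega> * ((norm (transpose T *v \<omega>))\<^sup>2 + \<mu>)"
  using assms by (simp add: alpha_def)

lemma alpha_mult_pos:
  assumes "\<mu> \<ge> 0" "transpose T *v \<omega> \<noteq> 0"
  shows "0 < alpha \<mu> \<omega> * ((norm (transpose T *v \<omega>))\<^sup>2 + \<mu>)"
proof -
  \<comment> \<open>This keeps the denominator of \<open>alpha\<close> positive even for \<mu> =
    0.\<close>
  have "\<omega> \<noteq> 0" using assms by auto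
  then show ?thesis
    using assms unfolding alpha_def by (intro mult_pos_pos divide_pos_pos add_pos_nonneg) auto
qed

text \<open>An operator bound K of \<open>transpose T\<close> gives a numerator of at most K^2
  |\<omega>|^2 + \<mu>. This is at most M times the denominator |\<omega>|^2 + \<mu> once M
  dominates both K^2, for the first term, and 1, for the second.\<close>

lemma alpha_mult_bounded:
  fixes T :: "real^'m^'n"
  assumes "\<mu> \<ge> 0"
  obtains M where "M \<ge> 1"
    "\<And>\<omega>. alpha \<mu> \<omega> * ((norm (transpose T *v \<omega>))\<^sup>2 + \<mu>) \<le> M"
proof -
  obtain K where K: "\<And>\<omega>. norm (transpose T *v \<omega>) \<le> norm \<omega> * K"
    using bounded_linear.bounded [OF matrix_vector_mul_bounded_linear [of "transpose T"]] by blast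
  define M where "M = max 1 (K\<^sup>2)"
  have M: "1 \<le> M" "K\<^sup>2 \<le> M" by (auto simp: M_def)
  have "alpha \<mu> \<omega> * ((norm (transpose T *v \<omega>))\<^sup>2 + \<mu>) \<le> M" for \<omega>
  proof -
    have "(norm (transpose T *v \<omega>))\<^sup>2 \<le> (norm \<omega> * K)\<^sup>2"
      by (intro power_mono K) auto
    also have "\<dots> \<le> (norm \<omega>)\<^sup>2 * M"
      unfolding power_mult_distrib by (intro mult_left_mono M) auto
    finally have "(norm (transpose T *v \<omega>))\<^sup>2 + \<mu> \<le> (norm \<omega>)\<^sup>2 * M + \<mu> * M"
      using mult_left_mono [OF M(1) assms] by simp
    then have "(norm (transpose T *v \<omega>))\<^sup>2 + \<mu> \<le> M * ((norm \<omega>)\<^sup>2 + \<mu>)"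
      by (simp add: algebra_simps)
    moreover have "0 \<le> (norm \<omega>)\<^sup>2 + \<mu>" using assms by simp
    \<comment> \<open>If the denominator vanishes, which happens for \<omega> = 0 and \<mu> = 0,
      then \<open>alpha\<close> is 1 / 0 = 0 and the product is 0.\<close>
    ultimately show ?thesis
      using M by (cases "(norm \<omega>)\<^sup>2 + \<mu> = 0") (auto simp: alpha_def divide_simps)
  qed
  with M show thesis by (intro that)
qed

text \<open>The argument of p stays in the compact interval [0, M], on which p is continuous. The
  bound may depend on p, which suffices for the finiteness of the norm of each single
  iterate.\<close>

lemma residual_factor_bounded:
  fixes T :: "real^'m^'n"
  assumes "\<mu> \<ge> 0"
  obtains B where "B \<ge> 0" "\<And>\<omega>. \<bar>residual_factor T \<mu> p \<omega>\<bar> \<le> B"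
proof -
  obtain M where M: "\<And>\<omega>. alpha \<mu> \<omega> * ((norm (transpose T *v \<omega>))\<^sup>2 + \<mu>) \<le> M"
    using alpha_mult_bounded [OF assms] by metis
  have "bounded (poly p ` {0..M})"
    by (intro compact_imp_bounded compact_continuous_image continuous_intros) auto
  then obtain B where B: "\<And>x. x \<in> {0..M} \<Longrightarrow> norm (poly p x) \<le> B"
    unfolding bounded_iff by blast
  have "\<bar>residual_factor T \<mu> p \<omega>\<bar> \<le> B" for \<omega>
    using B M alpha_mult_nonneg [OF assms] unfolding residual_factor_def by auto
  moreover from this have "B \<ge> 0" by (meson abs_ge_zero order_trans)
  ultimately show thesis by (intro that)
qed

lemma snorm_cong_AE:
  assumes "AE \<omega> in lebesgue. Uh \<omega> = Vh \<omega>"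
  shows "snorm T s Uh = snorm T s Vh"
  unfolding snorm_def by (rule nn_integral_cong_AE, use assms in eventually_elim) simp

text \<open>The weight is nonnegative, so the pointwise bound survives integration. Measurability of
  \<open>Uh\<close> allows C to be pulled out of the integral.\<close>

lemma snorm_finite_dominated:
  assumes "AE \<omega> in lebesgue. norm (Vh \<omega>) \<le> C * norm (Uh \<omega>)"
    and "Uh \<in> borel_measurable lebesgue" "C \<ge> 0" "snorm T s Uh < \<infinity>"
  shows "snorm T s Vh < \<infinity>"
proof -
  have "snorm T s Vh \<le>
      (\<integral>\<^sup>+\<omega>. ennreal C * ennreal (norm (transpose T *v \<omega>) powr s * norm (Uh \<omega>)) \<partial>lebesgue)"
    unfolding snorm_def
  proof (rule nn_integral_mono_AE, use assms(1) in eventually_elim)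
    fix \<omega> assume "norm (Vh \<omega>) \<le> C * norm (Uh \<omega>)"
    then have "norm (transpose T *v \<omega>) powr s * norm (Vh \<omega>)
        \<le> C * (norm (transpose T *v \<omega>) powr s * norm (Uh \<omega>))"
      using mult_left_mono [of "norm (Vh \<omega>)" "C * norm (Uh \<omega>)" "norm (transpose T *v \<omega>) powr s"]
      by (simp add: mult.left_commute)
    then show "ennreal (norm (transpose T *v \<omega>) powr s * norm (Vh \<omega>))
        \<le> ennreal C * ennreal (norm (transpose T *v \<omega>) powr s * norm (Uh \<omega>))"
      using assms(3) by (simp flip: ennreal_mult')
  qed
  also have "\<dots> = ennreal C * snorm T s Uh"
    unfolding snorm_def by (intro nn_integral_cmult borel_measurable_snorm_integrand assms)
  also have "\<dots> < \<infinity>"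
    using assms(4) by (simp add: ennreal_mult_less_top)
  finally show ?thesis .
qed

text \<open>Almost everywhere \<open>Vh k\<close> is \<open>Uh\<close> minus a multiple of
  \<open>Uh\<close> by a factor bounded by B, so the triangle inequality gives domination with
  constant 1 + B.\<close>

lemma iterates_snorm_finite:
  assumes "\<mu> \<ge> 0" "Uh \<in> borel_measurable lebesgue" "snorm T s Uh < \<infinity>" "iterates T \<mu> P Uh V Vh"
  shows "snorm T s (Vh k) < \<infinity>"
proof -
  obtain B where B: "B \<ge> 0" "\<And>\<omega>. \<bar>residual_factor T \<mu> (P k) \<omega>\<bar> \<le> B"
    using residual_factor_bounded [OF assms(1)] by metis
  have "AE \<omega> in lebesgue. Uh \<omega> - Vh k \<omega> = of_real (residual_factor T \<mu> (P k) \<omega>) * Uh \<omega>"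
    using assms(4) unfolding iterates_def by blast
  then have "AE \<omega> in lebesgue. norm (Vh k \<omega>) \<le> (1 + B) * norm (Uh \<omega>)"
  proof eventually_elim
    fix \<omega> assume eq: "Uh \<omega> - Vh k \<omega> = of_real (residual_factor T \<mu> (P k) \<omega>) * Uh \<omega>"
    have "norm (Vh k \<omega>) \<le> norm (Uh \<omega>) + norm (Uh \<omega> - Vh k \<omega>)"
      by (metis norm_minus_commute norm_triangle_sub)
    also have "norm (Uh \<omega> - Vh k \<omega>) \<le> B * norm (Uh \<omega>)"
      unfolding eq norm_mult norm_of_real by (intro mult_right_mono B) auto
    finally show "norm (Vh k \<omega>) \<le> (1 + B) * norm (Uh \<omega>)"
      by (simp add: algebra_simps)
  qed
  then show ?thesis
    by (rule snorm_finite_dominated) (use assms(2,3) B(1) in auto)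
qed

lemma iterates_snorm_error:
  assumes "iterates T \<mu> P Uh V Vh"
  shows "snorm T s (\<lambda>\<omega>. Uh \<omega> - Vh k \<omega>) =
    snorm T s (\<lambda>\<omega>. of_real (residual_factor T \<mu> (P k) \<omega>) * Uh \<omega>)"
proof -
  have "AE \<omega> in lebesgue. Uh \<omega> - Vh k \<omega> = of_real (residual_factor T \<mu> (P k) \<omega>) * Uh \<omega>"
    using assms unfolding iterates_def by blast
  then show ?thesis by (rule snorm_cong_AE)
qed

text \<open>Stated for the residual factors alone, because the polynomials have to be fixed before
  any iterates built from them are considered.\<close>

lemma exists_polys_snorm_residual_tendsto_0:
  fixes T :: "real^'m^'n"
  assumes "\<mu> \<ge> 0" "Uh \<in> borel_measurable lebesgue" "snorm T s Uh < \<infinity>"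
  shows "\<exists>P. admissible_polys P \<and>
    (\<lambda>k. snorm T s (\<lambda>\<omega>. of_real (residual_factor T \<mu> (P k) \<omega>) * Uh \<omega>)) \<longlonglongrightarrow> 0"
proof -
  obtain M where M: "M \<ge> 1" "\<And>\<omega>. alpha \<mu> \<omega> * ((norm (transpose T *v \<omega>))\<^sup>2 + \<mu>) \<le> M"
    using alpha_mult_bounded [OF assms(1), of T] by metis
  \<comment> \<open>A power of the linear polynomial with value 1 at 0 and zero at M: degree and
    normalization are then immediate, and the residual factor is a k-th power.\<close>
  define P where "P k = [:1, - (1 / M):] ^ k" for k
  \<comment> \<open>The factor by which each step multiplies the error at \<omega>. In general it is
    not bounded away from 1, since the argument t can come arbitrarily close to 0, so only pointwise
    convergence is available.\<close>
  define r where "r \<omega> = 1 - alpha \<mu> \<omega> * ((norm (transpose T *v \<omega>))\<^sup>2 + \<mu>) / M" for \<omega> :: "real^'n"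
  have residual: "residual_factor T \<mu> (P k) \<omega> = r \<omega> ^ k" for k \<omega>
    by (simp add: residual_factor_def P_def r_def)
  have r01: "0 \<le> r \<omega>" "r \<omega> \<le> 1" for \<omega>
    using M alpha_mult_nonneg [OF assms(1), of \<omega> T] by (auto simp: r_def)
  have r_less_1: "r \<omega> < 1" if "transpose T *v \<omega> \<noteq> 0" for \<omega>
    using M(1) alpha_mult_pos [OF assms(1) that] by (simp add: r_def)
  have "admissible_polys P"
    unfolding admissible_polys_def P_def
    by (auto intro: order_trans [OF degree_power_le])
  \<comment> \<open>The limit 0 is written as the integral of the zero function to fit
    \<open>nn_integral_dominated_convergence\<close>.\<close>
  moreover have "(\<lambda>k. snorm T s (\<lambda>\<omega>. of_real (residual_factor T \<mu> (P k) \<omega>) * Uh \<omega>))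
      \<longlonglongrightarrow> (\<integral>\<^sup>+\<omega>. 0 \<partial>(lebesgue :: (real^'n) measure))"
    unfolding snorm_def
  \<comment> \<open>Since 0 \<le> r \<le> 1, the integrand of \<open>snorm T s Uh\<close> dominates
    for every k, and its integral is finite by assumption.\<close>
  proof (rule nn_integral_dominated_convergence
      [where w = "\<lambda>\<omega>. ennreal (norm (transpose T *v \<omega>) powr s * norm (Uh \<omega>))"])
    show "(\<integral>\<^sup>+\<omega>. ennreal (norm (transpose T *v \<omega>) powr s * norm (Uh \<omega>)) \<partial>lebesgue) < \<infinity>"
      using assms(3) by (simp add: snorm_def)
    show "AE \<omega> in lebesgue. ennreal (norm (transpose T *v \<omega>) powr s
        * norm (of_real (residual_factor T \<mu> (P k) \<omega>) * Uh \<omega>))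
        \<le> ennreal (norm (transpose T *v \<omega>) powr s * norm (Uh \<omega>))" for k
      using r01 by (intro AE_I2 ennreal_leI mult_left_mono)
        (auto simp: residual norm_mult norm_power intro!: mult_left_le_one_le power_le_one)
    show "AE \<omega> in lebesgue. (\<lambda>k. ennreal (norm (transpose T *v \<omega>) powr s
        * norm (of_real (residual_factor T \<mu> (P k) \<omega>) * Uh \<omega>))) \<longlonglongrightarrow> 0"
    proof (rule AE_I2)
      fix \<omega> :: "real^'n"
      show "(\<lambda>k. ennreal (norm (transpose T *v \<omega>) powr s
          * norm (of_real (residual_factor T \<mu> (P k) \<omega>) * Uh \<omega>))) \<longlonglongrightarrow> 0"
      \<comment> \<open>On the kernel r can equal 1, namely for \<mu> = 0, and its powers then do
        not decay. There the integrand is zero because \<open>0 powr s = 0\<close>, also for s \<le>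
        0.\<close>
      proof (cases "transpose T *v \<omega> = 0")
        case False
        then have "(\<lambda>k. r \<omega> ^ k) \<longlonglongrightarrow> 0"
          using r01 r_less_1 by (intro LIMSEQ_power_zero) auto
        then have "(\<lambda>k. norm (transpose T *v \<omega>) powr s
            * norm (of_real (residual_factor T \<mu> (P k) \<omega>) * Uh \<omega>))
            \<longlonglongrightarrow> norm (transpose T *v \<omega>) powr s * norm (of_real 0 * Uh \<omega>)"
          unfolding residual by (intro tendsto_mult tendsto_const tendsto_norm tendsto_of_real)
        then show ?thesis
          by (intro tendsto_ennrealI [where x = 0, simplified]) auto
      qed simp
    qed
  qed (intro borel_measurable_const borel_measurable_snorm_integrand
      borel_measurable_residual_mult assms)+
  ultimately show ?thesis by auto
qed

theorem theorem4p1: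
  fixes T :: "real^'m^'n" and \<mu> s :: real
    and F U :: "real^'n \<Rightarrow> real" and Fh Uh :: "real^'n \<Rightarrow> complex"
  assumes "CARD('m) < CARD('n)"
    and "rank T = CARD('m)"
    and "1 / (real CARD('n) * measure lborel (ball 0 1 :: (real^'n) set)) *
           (\<integral>\<eta>. (norm (transpose T *v \<eta>))\<^sup>2 \<partial>sphere_measure) = 1"
    and "\<mu> \<ge> 0"
    and "fourier_repr F Fh"
    and "\<mu> = 0 \<Longrightarrow>
           integrable lebesgue (\<lambda>\<omega>. Fh \<omega> / of_real ((norm (transpose T *v \<omega>))\<^sup>2))"
    and "fourier_repr U Uh"
    and "\<And>y. L_op T Uh y + of_real (\<mu> * U y) = of_real (F y)"
    and "AE \<omega> in lebesgue. Uh \<omega> = Fh \<omega> / of_real ((norm (transpose T *v \<omega>))\<^sup>2 + \<mu>)"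
    and "snorm T s Uh < \<infinity>"
  shows "(\<forall>P V Vh. admissible_polys P \<and> iterates T \<mu> P Uh V Vh \<longrightarrow>
            (\<forall>k. snorm T s (Vh k) < \<infinity> \<and>
               snorm T s (\<lambda>\<omega>. Uh \<omega> - Vh k \<omega>) =
                 (\<integral>\<^sup>+\<omega>. ennreal (norm (transpose T *v \<omega>) powr s *
                    norm (of_real (residual_factor T \<mu> (P k) \<omega>) * Uh \<omega>)) \<partial>lebesgue))) \<and>
         (\<exists>P. admissible_polys P \<and>
            (\<lambda>k. \<integral>\<^sup>+\<omega>. ennreal (norm (transpose T *v \<omega>) powr s *
                    norm (of_real (residual_factor T \<mu> (P k) \<omega>) * Uh \<omega>)) \<partial>lebesgue)
              \<longlonglongrightarrow> 0 \<and>
            (\<forall>V Vh. iterates T \<mu> P Uh V Vh \<longrightarrow>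
               (\<lambda>k. snorm T s (\<lambda>\<omega>. Uh \<omega> - Vh k \<omega>)) \<longlonglongrightarrow> 0))"
proof -
  have Uh: "Uh \<in> borel_measurable lebesgue"
    using assms(7) unfolding fourier_repr_def by auto
  have finite: "snorm T s (Vh k) < \<infinity>" if "iterates T \<mu> P Uh V Vh" for P V Vh k
    using iterates_snorm_finite [OF assms(4) Uh assms(10) that] .
  have error: "snorm T s (\<lambda>\<omega>. Uh \<omega> - Vh k \<omega>) =
      (\<integral>\<^sup>+\<omega>. ennreal (norm (transpose T *v \<omega>) powr s *
        norm (of_real (residual_factor T \<mu> (P k) \<omega>) * Uh \<omega>)) \<partial>lebesgue)"
    if "iterates T \<mu> P Uh V Vh" for P V Vh k
    using iterates_snorm_error [OF that] unfolding snorm_def .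
  obtain P where P: "admissible_polys P"
    "(\<lambda>k. \<integral>\<^sup>+\<omega>. ennreal (norm (transpose T *v \<omega>) powr s *
        norm (of_real (residual_factor T \<mu> (P k) \<omega>) * Uh \<omega>)) \<partial>lebesgue) \<longlonglongrightarrow> 0"
    using exists_polys_snorm_residual_tendsto_0 [OF assms(4) Uh assms(10)]
    unfolding snorm_def by blast
  \<comment> \<open>The error norms equal the explicit integrals by \<open>error\<close>, so the
    convergence is the same for all iterates that realize P.\<close>
  have "(\<lambda>k. snorm T s (\<lambda>\<omega>. Uh \<omega> - Vh k \<omega>)) \<longlonglongrightarrow> 0" if "iterates T \<mu> P Uh V Vh" for V Vh
    using P(2) unfolding error [OF that] .
  with P have "\<exists>P. admissible_polys P \<and>
      (\<lambda>k. \<integral>\<^sup>+\<omega>. ennreal (norm (transpose T *v \<omega>) powr s *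
          norm (of_real (residual_factor T \<mu> (P k) \<omega>) * Uh \<omega>)) \<partial>lebesgue) \<longlonglongrightarrow> 0 \<and>
      (\<forall>V Vh. iterates T \<mu> P Uh V Vh \<longrightarrow> (\<lambda>k. snorm T s (\<lambda>\<omega>. Uh \<omega> - Vh k \<omega>)) \<longlonglongrightarrow> 0)"
    by (intro exI [of _ P] conjI allI impI)
  then show ?thesis
    by (intro conjI allI impI; (elim conjE)?) (rule finite error; assumption)+
qed

end
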